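(* Let $d\ge1$, $c:\mathbb{R}^d\times\mathbb{R}^d\to\mathbb{R}$ and $x_0\in\mathbb{R}^d$ be such that for all $y\in\mathbb{R}^d$, $c_x(x_0,y)=\sum_{i=1}^dP_i(y)u_i$, where $P_i\in\mathbb{R}[Y_1,\dots,Y_d]$ for $1\le i\le d$ and $(u_i)_{1\le i\le d}$ is a basis of $\mathbb{R}^d$. Suppose that $\deg(P_i)\ge 2$ for every $i$ and that the family $(P_1,\dots,P_d)$ is complete at infinity. If $S_0=\{y\in\mathbb{R}^d:c_x(x_0,y)=A(y)\}$ for some affine map $A:\mathbb{R}^d\to\mathbb{R}^d$, then $$|S_0|\le\deg(P_1)\cdots\deg(P_d).$$
   Context: $c_x$ is the gradient of $c$ in the first variable. For a polynomial $P=\sum_{|\alpha|\le\deg P}a_\alpha X^\alpha$, $P^{hom}:=\sum_{|\alpha|=\deg P}a_\alpha X^\alpha$ is its top-degree homogeneous part. A family $(P_1,\dots,P_k)$ in $\mathbb{R}[X_1,\dots,X_d]$ is complete at infinity if for every $1\le i\le k$ and every $Q\in\mathbb{R}[X_1,\dots,X_d]$ with $Q\notin\langle P_1^{hom},\dots,P_{i-1}^{hom}\rangle$ one has $QP_i^{hom}\notin\langle P_1^{hom},\dots,P_{i-1}^{hom}\rangle$, where $\langle\cdot\rangle$ is the generated ideal in $\mathbb{R}[X_1,\dots,X_d]$ and $\langle\emptyset\rangle=\{0\}$. *)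

theory Defs
  imports "HOL-Analysis.Analysis" "HOL-Library.Poly_Mapping"
begin

text \<open>Polynomials over the reals in the variables \<open>X\<^sub>i\<close>, \<open>i :: 'n\<close>, as the monoid algebra of
  \<open>'n \<Rightarrow>\<^sub>0 nat\<close>. A key \<open>\<alpha> :: 'n \<Rightarrow>\<^sub>0 nat\<close> is a multi-index, and \<open>Poly_Mapping.lookup p \<alpha>\<close> is the
  coefficient of \<open>X^\<alpha>\<close> in \<open>p\<close>.\<close>

type_synonym 'n real_mpoly = "('n \<Rightarrow>\<^sub>0 nat) \<Rightarrow>\<^sub>0 real"

definition monom_degree :: "('n::finite \<Rightarrow>\<^sub>0 nat) \<Rightarrow> nat" where
  "monom_degree \<alpha> = (\<Sum>i\<in>UNIV. Poly_Mapping.lookup \<alpha> i)"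

text \<open>Total degree; by convention the zero polynomial has degree \<open>0\<close>.\<close>

definition mpoly_degree :: "'n::finite real_mpoly \<Rightarrow> nat" where
  "mpoly_degree p = Max (insert 0 (monom_degree ` Poly_Mapping.keys p))"

definition mpoly_eval :: "'n::finite real_mpoly \<Rightarrow> real ^ 'n \<Rightarrow> real" where
  "mpoly_eval p y = (\<Sum>\<alpha>\<in>Poly_Mapping.keys p.
     Poly_Mapping.lookup p \<alpha> * (\<Prod>i\<in>UNIV. (y $ i) ^ Poly_Mapping.lookup \<alpha> i))"

definition top_hom :: "'n::finite real_mpoly \<Rightarrow> 'n real_mpoly" where
  "top_hom p = (\<Sum>\<alpha> | \<alpha> \<in> Poly_Mapping.keys p \<and> monom_degree \<alpha> = mpoly_degree p.
     Poly_Mapping.single \<alpha> (Poly_Mapping.lookup p \<alpha>))"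

lemma module_mult: "module ((*) :: 'a::comm_ring_1 \<Rightarrow> 'a \<Rightarrow> 'a)"
  by standard (simp_all add: algebra_simps)

text \<open>The ideal generated by \<open>S\<close> is its span in the ring regarded as a module over itself.\<close>

definition ideal_gen :: "'a::comm_ring_1 set \<Rightarrow> 'a set" where
  "ideal_gen S = module.span (*) S"

lemma ideal_gen_empty: "ideal_gen {} = {0}"
  unfolding ideal_gen_def by (rule module.span_empty[OF module_mult])

text \<open>Completeness at infinity of the ordered family \<open>P 1, \<dots>, P k\<close>.\<close>

definition complete_at_infinity :: "nat \<Rightarrow> (nat \<Rightarrow> 'n::finite real_mpoly) \<Rightarrow> bool" where
  "complete_at_infinity k P \<longleftrightarrow>
     (\<forall>i\<in>{1..k}. \<forall>Q. Q \<notin> ideal_gen ((\<lambda>j. top_hom (P j)) ` {1..<i}) \<longrightarrow>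
        Q * top_hom (P i) \<notin> ideal_gen ((\<lambda>j. top_hom (P j)) ` {1..<i}))"

text \<open>Only meaningful at points of differentiability.\<close>

definition gradient :: "('a::real_inner \<Rightarrow> real) \<Rightarrow> 'a \<Rightarrow> 'a" where
  "gradient f x = (THE D. GDERIV f x :> D)"

lemma gradient_eqI:
  assumes "GDERIV f x :> D"
  shows "gradient f x = D"
  unfolding gradient_def
proof (rule the_equality[where P = "\<lambda>D. GDERIV f x :> D", OF assms])
  fix D' assume "GDERIV f x :> D'"
  then have "(\<lambda>h. inner h D') = (\<lambda>h. inner h D)"
    using assms unfolding gderiv_def by (rule has_derivative_unique)
  then have "inner (D' - D) D' = inner (D' - D) D" by (rule fun_cong)
  then have "inner (D' - D) (D' - D) = 0" by (simp add: inner_diff_right)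
  then show "D' = D" by simp
qed

lemma GDERIV_gradient:
  fixes f :: "'a::euclidean_space \<Rightarrow> real"
  assumes "f differentiable (at x)"
  shows "GDERIV f x :> gradient f x"
proof -
  obtain f' where f': "(f has_derivative f') (at x)"
    using assms by (auto simp: differentiable_def)
  interpret bounded_linear f' using f' by (rule has_derivative_bounded_linear)
  have "f' h = inner h (\<Sum>b\<in>Basis. f' b *\<^sub>R b)" for h
    by (subst euclidean_representation[of h, symmetric])
      (simp add: sum scale inner_sum_right mult.commute)
  then have "f' = (\<lambda>h. inner h (\<Sum>b\<in>Basis. f' b *\<^sub>R b))" by blast
  with f' have "GDERIV f x :> (\<Sum>b\<in>Basis. f' b *\<^sub>R b)"
    unfolding gderiv_def by metis
  then show ?thesis using gradient_eqI by metis
qed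

text \<open>\<open>c\<^sub>x\<close>, the gradient of \<open>c\<close> in its first variable.\<close>

definition grad_fst :: "('a::real_inner \<times> 'b \<Rightarrow> real) \<Rightarrow> 'a \<Rightarrow> 'b \<Rightarrow> 'a" where
  "grad_fst c x y = gradient (\<lambda>x'. c (x', y)) x"

end

theory Submission
  imports Defs
begin

text \<open>Express the equation \<open>c\<^sub>x(x\<^sub>0, y) = A(y)\<close> in the basis \<open>u\<close>: the set \<open>S\<^sub>0\<close> is the common zero
  set of \<open>P\<^sub>i - A\<^sub>i\<close> with \<open>A\<^sub>i\<close> affine, and \<open>deg P\<^sub>i \<ge> 2\<close> makes \<open>p\<^sub>i = P\<^sub>i\<^sup>h\<^sup>o\<^sup>m\<close> its leading
  form. Completeness at infinity says that \<open>p\<^sub>1, \<dots>, p\<^sub>d\<close> is a regular sequence, so the graded ring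
  \<open>\<real>[X]/(p\<^sub>1, \<dots>, p\<^sub>d)\<close> has Hilbert series \<open>\<Prod>(1 - t^d\<^sub>i)/(1 - t)^d = \<Prod>(1 + t + \<dots> + t^(d\<^sub>i-1))\<close>,
  whose value at \<open>t = 1\<close> is \<open>\<Prod> d\<^sub>i\<close>. For a finite \<open>F \<subseteq> S\<^sub>0\<close> let \<open>E\<^sub>n\<close> be the space of functions on
  \<open>F\<close> that are values of polynomials of degree below \<open>n\<close>. A form of degree \<open>n\<close> in
  \<open>(p\<^sub>1, \<dots>, p\<^sub>d)\<close> agrees on \<open>F\<close> with a polynomial of smaller degree, so \<open>dim E\<^sub>n\<^sub>+\<^sub>1 - dim E\<^sub>n\<close> is at
  most the \<open>n\<close>-th coefficient of the series; by interpolation \<open>dim E\<^sub>n = |F|\<close> for large \<open>n\<close>.\<close>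

section \<open>Dimensions in spaces that need not be finite-dimensional\<close>

text \<open>Extend \<open>B\<close> to a basis of \<open>V\<close>. The finite spanning set
  \<open>W\<close> keeps that basis finite; at an infinite one \<open>card\<close>, and with it
  \<open>dim\<close>, would take the default value 0.\<close>

lemma independent_card_le_dim_of_finite_span:
  fixes B V W :: "'a::real_vector set"
  assumes "independent B" "B \<subseteq> V" "V \<subseteq> span W" "finite W"
  shows "card B \<le> dim V"
proof -
  obtain C where C: "B \<subseteq> C" "C \<subseteq> V" "independent C" "V \<subseteq> span C"
    using maximal_independent_subset_extend[OF assms(2,1)] by blast
  have "finite C"
    using independent_span_bound[OF assms(4) C(3)] C(2) assms(3) by blast
  moreover have "card C = dim V"
    using basis_card_eq_dim[OF C(2,4,3)] .
  ultimately show ?thesis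
    using card_mono[OF _ C(1)] by simp
qed

lemma dim_mono_of_finite_span:
  fixes U V W :: "'a::real_vector set"
  assumes "U \<subseteq> V" "V \<subseteq> span W" "finite W"
  shows "dim U \<le> dim V"
proof -
  obtain B where B: "B \<subseteq> U" "independent B" "U \<subseteq> span B" "card B = dim U"
    using basis_exists by blast
  then have "card B \<le> dim V"
    using assms by (intro independent_card_le_dim_of_finite_span[of B V W]) auto
  then show ?thesis using B(4) by simp
qed

text \<open>This is rank-nullity for the map from \<open>V\<close> to the quotient by
  \<open>U\<close> induced by \<open>f\<close>, phrased without quotient spaces. A basis
  \<open>K\<close> of the kernel is extended to a basis \<open>C\<close> of \<open>V\<close>; the
  images of \<open>C - K\<close> complete a basis of \<open>U\<close> to one of the sum.\<close>

lemma dim_sum_linear_image: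
  fixes f :: "'a::real_vector \<Rightarrow> 'b::real_vector"
  assumes f: "linear f" and U: "subspace U" and V: "subspace V"
    and fin: "U \<subseteq> span W" "finite W" "V \<subseteq> span W'" "finite W'"
  shows "dim {u + f v | u v. u \<in> U \<and> v \<in> V} + dim {v \<in> V. f v \<in> U} = dim U + dim V"
proof -
  define N where "N = {v \<in> V. f v \<in> U}"
  define S where "S = {u + f v | u v. u \<in> U \<and> v \<in> V}"
  obtain B where B: "B \<subseteq> U" "independent B" "U \<subseteq> span B" "card B = dim U"
    using basis_exists by blast
  obtain K where K: "K \<subseteq> N" "independent K" "N \<subseteq> span K" "card K = dim N"
    using basis_exists by blast
  have "K \<subseteq> V" using K(1) by (auto simp: N_def)
  then obtain C where C: "K \<subseteq> C" "C \<subseteq> V" "independent C" "V \<subseteq> span C"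
    using maximal_independent_subset_extend K(2) by blast
  have finC: "finite C"
    using independent_span_bound[OF fin(4) C(3)] C(2) fin(3) by blast
  have finB: "finite B"
    using independent_span_bound[OF fin(2) B(2)] B(1) fin(1) by blast
  have cardC: "card C = dim V"
    using basis_card_eq_dim[OF C(2,4,3)] .
  have spanB: "span B \<subseteq> U" using B(1) U by (simp add: span_minimal)
  \<comment> \<open>Independence and cardinality are proved together: each added \<open>f d\<close>
    lies outside the span so far, hence is a new element.\<close>
  have ind: "independent (B \<union> f ` D) \<and> card (B \<union> f ` D) = card B + card D"
    if "D \<subseteq> C - K" for D
  proof -
    have "finite D" using that finC finite_subset by blast
    then show ?thesis using that
    proof (induction D)
      case empty
      then show ?case using B by simp
    next
      case (insert d D)
      \<comment> \<open>A relation \<open>f d = x + f w\<close> with \<open>x\<close> in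
        \<open>U\<close> would put \<open>d - w\<close> into the kernel, hence into
        \<open>span K\<close>, so \<open>d\<close> would depend on the rest of
        \<open>C\<close>.\<close>
      have fd: "f d \<notin> span (B \<union> f ` D)"
      proof
        assume "f d \<in> span (B \<union> f ` D)"
        then obtain x y where xy: "f d = x + y" "x \<in> span B" "y \<in> span (f ` D)"
          unfolding span_Un by blast
        then obtain w where w: "w \<in> span D" "y = f w"
          using linear_span_image[OF f] by auto
        have "span D \<subseteq> V"
          using insert.prems C(2) V by (intro span_minimal) auto
        then have "d - w \<in> V"
          using w insert.prems C(2) V by (auto intro!: subspace_diff)
        moreover have "f (d - w) \<in> U"
          using xy w spanB by (auto simp: linear_diff[OF f])
        ultimately have "d - w \<in> span K" using K(3) by (auto simp: N_def)
        moreover have "span K \<subseteq> span (C - {d})" "span D \<subseteq> span (C - {d})"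
          using insert.prems insert.hyps C(1) by (auto intro!: span_mono)
        ultimately have "(d - w) + w \<in> span (C - {d})"
          using w by (intro span_add) auto
        then show False
          using C(3) insert.prems by (auto simp: dependent_def)
      qed
      have IH: "independent (B \<union> f ` D)" "card (B \<union> f ` D) = card B + card D"
        using insert.IH insert.prems by auto
      moreover have "f d \<notin> B \<union> f ` D"
        using fd span_base[of "f d" "B \<union> f ` D"] by argo
      ultimately show ?case
        using independent_insertI[OF fd IH(1)] insert.hyps finB by simp
    qed
  qed
  define D where "D = C - K"
  have D: "independent (B \<union> f ` D)" "card (B \<union> f ` D) = card B + card D"
    using ind[of D] by (auto simp: D_def)
  have "B \<union> f ` D \<subseteq> S"
  proof
    fix x assume "x \<in> B \<union> f ` D"
    then consider "x \<in> U" | d where "x = f d" "d \<in> V"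
      using B(1) C(2) by (auto simp: D_def)
    then show "x \<in> S"
    proof cases
      case 1
      then have "x = x + f 0" "x \<in> U \<and> 0 \<in> V" using V by (auto simp: linear_0[OF f] subspace_0)
      then show ?thesis unfolding S_def by blast
    next
      case 2
      then have "x = 0 + f d" "0 \<in> U \<and> d \<in> V" using U by (auto simp: subspace_0)
      then show ?thesis unfolding S_def by blast
    qed
  qed
  moreover have "S \<subseteq> span (B \<union> f ` D)"
  proof
    fix x assume "x \<in> S"
    then obtain u v where uv: "x = u + f v" "u \<in> U" "v \<in> V" by (auto simp: S_def)
    have "f ` C \<subseteq> span (B \<union> f ` D)"
    proof
      fix y assume "y \<in> f ` C"
      then obtain z where z: "y = f z" "z \<in> C" by blast
      \<comment> \<open>Vectors of \<open>K\<close> need no image in the basis: \<open>f\<close>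
        sends them into \<open>U\<close>, which \<open>B\<close> spans.\<close>
      show "y \<in> span (B \<union> f ` D)"
      proof (cases "z \<in> K")
        case True
        then have "y \<in> U" using K(1) z by (auto simp: N_def)
        then show ?thesis using B(3) span_mono[of B "B \<union> f ` D"] by blast
      next
        case False
        then show ?thesis using z by (auto simp: D_def intro!: span_base)
      qed
    qed
    then have "span (f ` C) \<subseteq> span (B \<union> f ` D)" by (simp add: span_minimal)
    moreover have "f v \<in> span (f ` C)"
      using C(4) uv(3) linear_span_image[OF f] by blast
    moreover have "u \<in> span (B \<union> f ` D)"
      using B(3) span_mono[of B "B \<union> f ` D"] uv(2) by blast
    ultimately show "x \<in> span (B \<union> f ` D)"
      using uv(1) by (auto intro: span_add)
  qed
  ultimately have "card (B \<union> f ` D) = dim S"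
    using D(1) by (intro basis_card_eq_dim)
  moreover have "card D + card K = card C"
    using C(1) finC by (metis D_def card_Diff_subset card_mono finite_subset le_add_diff_inverse2)
  ultimately show ?thesis
    using D(2) B(4) K(4) cardC unfolding S_def N_def by linarith
qed

section \<open>Finitely supported functions as a real vector space\<close>

text \<open>The instance serves twice: with exponents as keys for polynomials, and with points as
  keys for vectors of values.\<close>

instantiation poly_mapping :: (type, real_vector) real_vector
begin

lift_definition scaleR_poly_mapping :: "real \<Rightarrow> ('a \<Rightarrow>\<^sub>0 'b) \<Rightarrow> ('a \<Rightarrow>\<^sub>0 'b)"
  is "\<lambda>r f k. r *\<^sub>R f k"
  by (rule finite_subset[rotated]) auto

instance
  by standard (transfer; auto simp: algebra_simps)+

end

lemma lookup_scaleR: "Poly_Mapping.lookup (r *\<^sub>R p) k = r *\<^sub>R Poly_Mapping.lookup p k"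
  by transfer simp

lemma scaleR_single: "r *\<^sub>R Poly_Mapping.single k c = Poly_Mapping.single k (r *\<^sub>R c)"
  by (rule poly_mapping_eqI) (simp add: lookup_scaleR lookup_single when_def)

text \<open>Scaling as a product with a constant polynomial makes every ideal a real
  subspace.\<close>

lemma scaleR_eq_single_mult:
  fixes p :: "'a::monoid_add \<Rightarrow>\<^sub>0 real"
  shows "r *\<^sub>R p = Poly_Mapping.single 0 r * p"
  by (simp add: poly_mapping_eq_iff fun_eq_iff lookup_scaleR map.rep_eq when_def
      flip: mult_map_scale_conv_mult)

lemma poly_mapping_eq_sum_single:
  "p = (\<Sum>k\<in>Poly_Mapping.keys p. Poly_Mapping.single k (Poly_Mapping.lookup p k))"
  by (rule poly_mapping_eqI)
    (simp add: lookup_sum lookup_single when_def in_keys_iff)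

lemma poly_mapping_add_induct [case_names zero single add]:
  fixes p :: "'a \<Rightarrow>\<^sub>0 'b::comm_monoid_add"
  assumes "P 0" "\<And>k c. P (Poly_Mapping.single k c)" "\<And>p q. P p \<Longrightarrow> P q \<Longrightarrow> P (p + q)"
  shows "P p"
proof -
  have "P (\<Sum>k\<in>K. Poly_Mapping.single k (Poly_Mapping.lookup p k))" if "finite K" for K
    using that by induction (auto intro: assms)
  then show ?thesis using poly_mapping_eq_sum_single[of p] finite_keys by metis
qed

definition keys_within :: "'a set \<Rightarrow> ('a \<Rightarrow>\<^sub>0 'b::zero) set" where
  "keys_within M = {p. Poly_Mapping.keys p \<subseteq> M}"

lift_definition restrict_keys :: "'a set \<Rightarrow> ('a \<Rightarrow>\<^sub>0 'b::zero) \<Rightarrow> ('a \<Rightarrow>\<^sub>0 'b)"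
  is "\<lambda>M f k. if k \<in> M then f k else 0"
  by (rule finite_subset[rotated]) auto

lemma lookup_restrict_keys:
  "Poly_Mapping.lookup (restrict_keys M p) k = (if k \<in> M then Poly_Mapping.lookup p k else 0)"
  by transfer simp

lemma restrict_keys_zero [simp]: "restrict_keys M 0 = 0"
  by (rule poly_mapping_eqI) (simp add: lookup_restrict_keys)

lemma restrict_keys_add: "restrict_keys M (p + q) = restrict_keys M p + restrict_keys M q"
  by (rule poly_mapping_eqI) (simp add: lookup_restrict_keys lookup_add)

lemma restrict_keys_single:
  "restrict_keys M (Poly_Mapping.single k c) = (if k \<in> M then Poly_Mapping.single k c else 0)"
  by (rule poly_mapping_eqI) (simp add: lookup_restrict_keys lookup_single when_def)

lemma restrict_keys_in_keys_within: "restrict_keys M p \<in> keys_within M"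
  by (auto simp: keys_within_def in_keys_iff lookup_restrict_keys split: if_splits)

lemma restrict_keys_id: "p \<in> keys_within M \<Longrightarrow> restrict_keys M p = p"
  by (rule poly_mapping_eqI) (auto simp: keys_within_def in_keys_iff lookup_restrict_keys)

lemma restrict_keys_disjoint: "p \<in> keys_within M \<Longrightarrow> M \<inter> M' = {} \<Longrightarrow> restrict_keys M' p = 0"
  by (rule poly_mapping_eqI) (auto simp: keys_within_def in_keys_iff lookup_restrict_keys)

lemma subspace_keys_within: "subspace (keys_within M :: ('a \<Rightarrow>\<^sub>0 'b::real_vector) set)"
  by (auto simp: subspace_def keys_within_def in_keys_iff lookup_add lookup_scaleR subset_iff)
    (metis add_0)

lemma keys_within_span:
  "(keys_within M :: ('a \<Rightarrow>\<^sub>0 real) set) \<subseteq> span ((\<lambda>k. Poly_Mapping.single k 1) ` M)"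
proof
  fix p :: "'a \<Rightarrow>\<^sub>0 real" assume p: "p \<in> keys_within M"
  have "p = (\<Sum>k\<in>Poly_Mapping.keys p. Poly_Mapping.lookup p k *\<^sub>R Poly_Mapping.single k 1)"
    by (subst poly_mapping_eq_sum_single) (simp add: scaleR_single)
  also have "\<dots> \<in> span ((\<lambda>k. Poly_Mapping.single k 1) ` M)"
    using p by (intro span_sum span_scale span_base) (auto simp: keys_within_def)
  finally show "p \<in> span ((\<lambda>k. Poly_Mapping.single k 1) ` M)" .
qed

text \<open>The other vectors lie in the subspace \<open>keys_within (- {k})\<close>, which misses
  \<open>Poly_Mapping.single k 1\<close>.\<close>

lemma independent_single_one:
  assumes "finite M"
  shows "independent ((\<lambda>k. Poly_Mapping.single k (1::real)) ` M)"
  unfolding dependent_def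
proof
  assume "\<exists>a\<in>(\<lambda>k. Poly_Mapping.single k (1::real)) ` M.
     a \<in> span ((\<lambda>k. Poly_Mapping.single k 1) ` M - {a})"
  then obtain k where k: "k \<in> M"
    "Poly_Mapping.single k (1::real) \<in> span ((\<lambda>k. Poly_Mapping.single k 1) ` M - {Poly_Mapping.single k 1})"
    by blast
  have "(\<lambda>k. Poly_Mapping.single k (1::real)) ` M - {Poly_Mapping.single k 1} \<subseteq> keys_within (- {k})"
    by (auto simp: keys_within_def)
  then have "Poly_Mapping.single k (1::real) \<in> keys_within (- {k})"
    using k(2) span_minimal[OF _ subspace_keys_within] by blast
  then show False by (simp add: keys_within_def)
qed

lemma card_single_one: "card ((\<lambda>k. Poly_Mapping.single k (1::real)) ` M) = card M"
proof (rule card_image, rule inj_onI)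
  fix k l :: 'a
  assume "Poly_Mapping.single k (1::real) = Poly_Mapping.single l 1"
  then have "Poly_Mapping.lookup (Poly_Mapping.single k (1::real)) k = Poly_Mapping.lookup (Poly_Mapping.single l 1) k"
    by simp
  then show "k = l" by (simp add: lookup_single when_def split: if_splits)
qed

lemma dim_keys_within:
  assumes "finite M"
  shows "dim (keys_within M :: ('a \<Rightarrow>\<^sub>0 real) set) = card M"
proof -
  have "(\<lambda>k. Poly_Mapping.single k (1::real)) ` M \<subseteq> keys_within M"
    by (auto simp: keys_within_def)
  from basis_card_eq_dim[OF this keys_within_span independent_single_one[OF assms]]
  show ?thesis by (simp add: card_single_one)
qed

section \<open>Homogeneous polynomials and homogeneous ideals\<close>

lemma monom_degree_add: "monom_degree (\<alpha> + \<beta>) = monom_degree \<alpha> + monom_degree \<beta>"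
  by (simp add: monom_degree_def lookup_add sum.distrib)

lemma monom_degree_single [simp]: "monom_degree (Poly_Mapping.single i n) = n"
  by (simp add: monom_degree_def lookup_single when_def)

lemma monom_degree_zero [simp]: "monom_degree 0 = 0"
  by (simp add: monom_degree_def)

lemma finite_monom_degree_le: "finite {\<alpha> :: 'n::finite \<Rightarrow>\<^sub>0 nat. monom_degree \<alpha> \<le> n}"
proof -
  have "Poly_Mapping.lookup ` {\<alpha> :: 'n \<Rightarrow>\<^sub>0 nat. monom_degree \<alpha> \<le> n} \<subseteq> PiE UNIV (\<lambda>_. {..n})"
  proof -
    have "Poly_Mapping.lookup \<alpha> i \<le> monom_degree \<alpha>" for \<alpha> :: "'n \<Rightarrow>\<^sub>0 nat" and i
      using member_le_sum[of i UNIV "Poly_Mapping.lookup \<alpha>"] by (simp add: monom_degree_def)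
    then show ?thesis by (auto intro: order_trans)
  qed
  then have "finite (Poly_Mapping.lookup ` {\<alpha> :: 'n \<Rightarrow>\<^sub>0 nat. monom_degree \<alpha> \<le> n})"
    by (rule finite_subset) (auto intro: finite_PiE)
  then show ?thesis
    by (rule finite_imageD) (auto simp: inj_on_def)
qed

definition homogeneous_polys :: "nat \<Rightarrow> 'n::finite real_mpoly set" where
  "homogeneous_polys n = keys_within {\<alpha>. monom_degree \<alpha> = n}"

text \<open>With a strict bound, \<open>polys_below 0\<close> is the zero space, where the dimension
  count starts.\<close>

definition polys_below :: "nat \<Rightarrow> 'n::finite real_mpoly set" where
  "polys_below n = keys_within {\<alpha>. monom_degree \<alpha> < n}"

abbreviation hom_part :: "nat \<Rightarrow> 'n::finite real_mpoly \<Rightarrow> 'n real_mpoly" where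
  "hom_part n \<equiv> restrict_keys {\<alpha>. monom_degree \<alpha> = n}"

lemma finite_monom_degree_eq: "finite {\<alpha> :: 'n::finite \<Rightarrow>\<^sub>0 nat. monom_degree \<alpha> = n}"
  by (rule finite_subset[OF _ finite_monom_degree_le[of n]]) auto

lemma subspace_homogeneous_polys: "subspace (homogeneous_polys n)"
  unfolding homogeneous_polys_def by (rule subspace_keys_within)

lemma subspace_polys_below: "subspace (polys_below n)"
  unfolding polys_below_def by (rule subspace_keys_within)

lemma homogeneous_polys_finite_span:
  obtains W :: "'n::finite real_mpoly set" where "finite W" "homogeneous_polys n \<subseteq> span W"
  using keys_within_span finite_monom_degree_eq unfolding homogeneous_polys_def
  by (metis finite_imageI)

section \<open>Grading of products and of ideals generated by forms\<close>

lemma homogeneous_polys_mult: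
  assumes "p \<in> homogeneous_polys m" "q \<in> homogeneous_polys n"
  shows "p * q \<in> homogeneous_polys (m + n)"
  using assms keys_mult[of p q]
  by (fastforce simp: homogeneous_polys_def keys_within_def monom_degree_add)

lemma homogeneous_mult_polys_below:
  assumes "p \<in> homogeneous_polys m" "q \<in> polys_below n"
  shows "p * q \<in> polys_below (m + n)"
  using assms keys_mult[of p q]
  by (fastforce simp: homogeneous_polys_def polys_below_def keys_within_def monom_degree_add)

text \<open>By additivity \<open>c\<close> may be a single monomial; then \<open>c * s\<close> is a
  form, kept or killed according to its degree. The case split is essential, since
  \<open>n - d\<close> is truncated to 0 when \<open>n < d\<close>.\<close>

lemma hom_part_mult_homogeneous:
  assumes "s \<in> homogeneous_polys d"
  shows "hom_part n (c * s) = (if d \<le> n then hom_part (n - d) c * s else 0)"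
proof (induction c rule: poly_mapping_add_induct)
  case (single k c)
  have "Poly_Mapping.single k c \<in> homogeneous_polys (monom_degree k)"
    by (simp add: homogeneous_polys_def keys_within_def)
  from homogeneous_polys_mult[OF this assms]
  have ks: "Poly_Mapping.single k c * s \<in> homogeneous_polys (monom_degree k + d)" .
  show ?case
  proof (cases "monom_degree k + d = n")
    case True
    then show ?thesis
      using ks by (auto simp: homogeneous_polys_def restrict_keys_id restrict_keys_single)
  next
    case False
    then have "hom_part n (Poly_Mapping.single k c * s) = 0"
      using ks by (auto simp: homogeneous_polys_def intro!: restrict_keys_disjoint)
    then show ?thesis using False by (auto simp: restrict_keys_single)
  qed
next
  case (add p q)
  then show ?case by (auto simp: restrict_keys_add distrib_right)
qed simp

interpretation ring_module: module "(*) :: 'a::comm_ring_1 \<Rightarrow> 'a \<Rightarrow> 'a"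
  by (rule module_mult)

lemma subspace_ideal_gen:
  fixes S :: "('a::comm_monoid_add \<Rightarrow>\<^sub>0 real) set"
  shows "subspace (ideal_gen S)"
  unfolding ideal_gen_def subspace_def scaleR_eq_single_mult
  by (auto intro: ring_module.span_zero ring_module.span_add ring_module.span_scale)

text \<open>In a sum of multiples of forms, passing to degree \<open>n\<close> only replaces each
  coefficient by one of its components or by 0.\<close>

lemma hom_part_ideal_gen:
  assumes "\<And>s. s \<in> S \<Longrightarrow> \<exists>d. s \<in> homogeneous_polys d" and "x \<in> ideal_gen S"
  shows "hom_part n x \<in> ideal_gen S"
  using assms(2) unfolding ideal_gen_def
proof (induction rule: ring_module.span_induct_alt)
  case base
  then show ?case by (simp add: ring_module.span_zero)
next
  case (step c s y)
  then obtain d where "s \<in> homogeneous_polys d" using assms(1) by blast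
  from hom_part_mult_homogeneous[OF this, of n c]
  have "hom_part n (c * s) \<in> module.span (*) S"
    using step by (auto intro: ring_module.span_zero ring_module.span_scale ring_module.span_base)
  then show ?case using step by (simp add: restrict_keys_add ring_module.span_add)
qed

text \<open>Some multiple \<open>q * p\<close> differs from \<open>x\<close> by an element of the
  ideal of \<open>S\<close>. Comparing components of degree \<open>n\<close> makes both summands
  homogeneous, so that dimensions can be counted degree by degree.\<close>

lemma ideal_gen_insert_homogeneous:
  assumes hom: "\<And>s. s \<in> S \<Longrightarrow> \<exists>d. s \<in> homogeneous_polys d" and p: "p \<in> homogeneous_polys d"
    and "d \<le> n"
  shows "ideal_gen (insert p S) \<inter> homogeneous_polys n =
    {a + q * p | a q. a \<in> ideal_gen S \<inter> homogeneous_polys n \<and> q \<in> homogeneous_polys (n - d)}"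
proof (intro equalityI subsetI)
  fix x assume x: "x \<in> ideal_gen (insert p S) \<inter> homogeneous_polys n"
  then obtain q where q: "x - q * p \<in> ideal_gen S"
    unfolding ideal_gen_def ring_module.span_insert by blast
  define a where "a = hom_part n (x - q * p)"
  have "a \<in> ideal_gen S \<inter> homogeneous_polys n"
    using hom_part_ideal_gen[OF hom q] restrict_keys_in_keys_within
    unfolding a_def homogeneous_polys_def by blast
  moreover have "hom_part (n - d) q \<in> homogeneous_polys (n - d)"
    unfolding homogeneous_polys_def by (rule restrict_keys_in_keys_within)
  moreover have "x = a + hom_part (n - d) q * p"
  proof -
    have "x = hom_part n x" using x by (simp add: homogeneous_polys_def restrict_keys_id)
    also have "\<dots> = hom_part n ((x - q * p) + q * p)" by simp
    also have "\<dots> = a + hom_part (n - d) q * p"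
      unfolding restrict_keys_add a_def using hom_part_mult_homogeneous[OF p, of n q] \<open>d \<le> n\<close> by simp
    finally show ?thesis .
  qed
  ultimately show "x \<in> {a + q * p | a q. a \<in> ideal_gen S \<inter> homogeneous_polys n \<and> q \<in> homogeneous_polys (n - d)}"
    by blast
next
  fix x assume "x \<in> {a + q * p | a q. a \<in> ideal_gen S \<inter> homogeneous_polys n \<and> q \<in> homogeneous_polys (n - d)}"
  then obtain a q where x: "x = a + q * p" "a \<in> ideal_gen S" "a \<in> homogeneous_polys n"
    "q \<in> homogeneous_polys (n - d)" by blast
  have "a \<in> ideal_gen (insert p S)"
    using x(2) ring_module.span_mono[of S "insert p S"] unfolding ideal_gen_def by blast
  moreover have "q * p \<in> ideal_gen (insert p S)"
    unfolding ideal_gen_def by (auto intro: ring_module.span_scale ring_module.span_base)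
  moreover have "q * p \<in> homogeneous_polys n"
    using homogeneous_polys_mult[OF x(4) p] \<open>d \<le> n\<close> by simp
  ultimately show "x \<in> ideal_gen (insert p S) \<inter> homogeneous_polys n"
    using x subspace_add[OF subspace_ideal_gen, of a "insert p S"]
      subspace_add[OF subspace_homogeneous_polys, of a n] by auto
qed

text \<open>A multiple of \<open>p\<close> has no component in a degree below \<open>d\<close>, so
  it disappears from the comparison.\<close>

lemma ideal_gen_insert_homogeneous_less:
  assumes hom: "\<And>s. s \<in> S \<Longrightarrow> \<exists>d. s \<in> homogeneous_polys d" and p: "p \<in> homogeneous_polys d"
    and "n < d"
  shows "ideal_gen (insert p S) \<inter> homogeneous_polys n = ideal_gen S \<inter> homogeneous_polys n"
proof (intro equalityI subsetI)
  fix x assume x: "x \<in> ideal_gen (insert p S) \<inter> homogeneous_polys n"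
  then obtain q where q: "x - q * p \<in> ideal_gen S"
    unfolding ideal_gen_def ring_module.span_insert by blast
  have "x = hom_part n ((x - q * p) + q * p)"
    using x by (simp add: homogeneous_polys_def restrict_keys_id)
  also have "\<dots> = hom_part n (x - q * p)"
    unfolding restrict_keys_add using hom_part_mult_homogeneous[OF p, of n q] \<open>n < d\<close> by simp
  finally show "x \<in> ideal_gen S \<inter> homogeneous_polys n"
    using hom_part_ideal_gen[OF hom q, of n] x by simp
next
  fix x assume "x \<in> ideal_gen S \<inter> homogeneous_polys n"
  then show "x \<in> ideal_gen (insert p S) \<inter> homogeneous_polys n"
    using ring_module.span_mono[of S "insert p S"] unfolding ideal_gen_def by blast
qed

text \<open>Multiplication by \<open>p\<close> is studied from degree \<open>n - d\<close> to degree
  \<open>n\<close> modulo the ideal of \<open>S\<close>. By regularity its kernel there is exactly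
  the part of the ideal in degree \<open>n - d\<close>.\<close>

lemma dim_ideal_gen_insert_homogeneous:
  fixes p :: "'n::finite real_mpoly"
  assumes hom: "\<And>s. s \<in> S \<Longrightarrow> \<exists>d. s \<in> homogeneous_polys d" and p: "p \<in> homogeneous_polys d"
    and "d \<le> n" and reg: "\<And>q. q * p \<in> ideal_gen S \<Longrightarrow> q \<in> ideal_gen S"
  shows "dim (ideal_gen (insert p S) \<inter> homogeneous_polys n) + dim (ideal_gen S \<inter> homogeneous_polys (n - d))
    = dim (ideal_gen S \<inter> homogeneous_polys n) + dim (homogeneous_polys (n - d) :: 'n real_mpoly set)"
proof -
  let ?U = "ideal_gen S \<inter> homogeneous_polys n" and ?V = "homogeneous_polys (n - d) :: 'n real_mpoly set"
  obtain W :: "'n real_mpoly set" where W: "finite W" "homogeneous_polys n \<subseteq> span W"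
    by (rule homogeneous_polys_finite_span)
  obtain W' :: "'n real_mpoly set" where W': "finite W'" "?V \<subseteq> span W'"
    by (rule homogeneous_polys_finite_span)
  have lin: "linear (\<lambda>q. q * p)"
    by (rule linearI) (simp_all only: distrib_right scaleR_eq_single_mult mult.assoc)
  have ker: "{q \<in> ?V. q * p \<in> ?U} = ideal_gen S \<inter> ?V"
  proof (intro equalityI subsetI)
    fix q assume q: "q \<in> ideal_gen S \<inter> ?V"
    then have "q * p \<in> ideal_gen S"
      using ring_module.span_scale[of q S p] by (simp add: ideal_gen_def mult.commute)
    moreover have "q * p \<in> homogeneous_polys n"
      using homogeneous_polys_mult[OF _ p, of q "n - d"] q \<open>d \<le> n\<close> by simp
    ultimately show "q \<in> {q \<in> ?V. q * p \<in> ?U}" using q by blast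
  qed (use reg in blast)
  have subU: "subspace ?U"
    by (intro subspace_inter subspace_ideal_gen subspace_homogeneous_polys)
  have UW: "?U \<subseteq> span W" using W(2) by blast
  have "ideal_gen (insert p S) \<inter> homogeneous_polys n = {a + q * p | a q. a \<in> ?U \<and> q \<in> ?V}"
    by (rule ideal_gen_insert_homogeneous[OF hom p \<open>d \<le> n\<close>])
  then show ?thesis
    using dim_sum_linear_image[OF lin subU subspace_homogeneous_polys UW W(1) W'(2,1)]
    unfolding ker by simp
qed

section \<open>The Hilbert series of a regular sequence\<close>

text \<open>Split the monomials by divisibility by the variable \<open>a\<close>; dividing by it
  lowers the degree by one.\<close>

lemma card_monomials_insert:
  fixes A :: "'n::finite set"
  assumes "a \<notin> A"
  defines "M \<equiv> \<lambda>B n. {\<alpha> :: 'n \<Rightarrow>\<^sub>0 nat. Poly_Mapping.keys \<alpha> \<subseteq> B \<and> monom_degree \<alpha> = n}"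
  shows "card (M (insert a A) n) = card (M A n) + (if n = 0 then 0 else card (M (insert a A) (n - 1)))"
proof -
  define M' where "M' = {\<alpha> \<in> M (insert a A) n. Poly_Mapping.lookup \<alpha> a \<noteq> 0}"
  have fin: "finite (M B m)" for B m
    unfolding M_def by (rule finite_subset[OF _ finite_monom_degree_le[of m]]) auto
  have "M (insert a A) n = M A n \<union> M'"
    by (auto simp: M_def M'_def in_keys_iff)
  moreover have "M A n \<inter> M' = {}"
    using assms(1) by (auto simp: M_def M'_def in_keys_iff subset_iff)
  ultimately have "card (M (insert a A) n) = card (M A n) + card M'"
    using fin[of A n] fin[of "insert a A" n] by (simp add: card_Un_disjoint)
  moreover have "card M' = (if n = 0 then 0 else card (M (insert a A) (n - 1)))"
  proof (cases "n = 0")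
    case True
    have "Poly_Mapping.lookup \<alpha> a \<le> monom_degree \<alpha>" for \<alpha> :: "'n \<Rightarrow>\<^sub>0 nat"
      unfolding monom_degree_def by (rule member_le_sum) auto
    then have "monom_degree \<alpha> > 0" if "Poly_Mapping.lookup \<alpha> a > 0" for \<alpha> :: "'n \<Rightarrow>\<^sub>0 nat"
      using that order_less_le_trans by blast
    then have "M' = {}" using True by (auto simp: M'_def M_def)
    then show ?thesis using True by simp
  next
    case False
    have "bij_betw (\<lambda>\<alpha>. \<alpha> + Poly_Mapping.single a 1) (M (insert a A) (n - 1)) M'"
    proof (rule bij_betw_byWitness[where f' = "\<lambda>\<alpha>. \<alpha> - Poly_Mapping.single a 1"])
      \<comment> \<open>Subtraction of exponents is truncated, and cancels here because members of
        \<open>M'\<close> have a nonzero exponent at \<open>a\<close>.\<close>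
      have le: "\<alpha> - Poly_Mapping.single a 1 + Poly_Mapping.single a 1 = \<alpha>"
        if "\<alpha> \<in> M'" for \<alpha>
        using that by (intro poly_mapping_eqI)
          (auto simp: M'_def lookup_add lookup_minus lookup_single when_def)
      then show "\<forall>\<alpha>\<in>M'. \<alpha> - Poly_Mapping.single a 1 + Poly_Mapping.single a 1 = \<alpha>" by blast
      show "(\<lambda>\<alpha>. \<alpha> - Poly_Mapping.single a 1) ` M' \<subseteq> M (insert a A) (n - 1)"
      proof clarify
        fix \<alpha> assume \<alpha>: "\<alpha> \<in> M'"
        have "monom_degree (\<alpha> - Poly_Mapping.single a 1) + 1 = n"
          using arg_cong[OF le[OF \<alpha>], of monom_degree] \<alpha>
          by (simp add: monom_degree_add M'_def M_def)
        then show "\<alpha> - Poly_Mapping.single a 1 \<in> M (insert a A) (n - 1)"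
          using \<alpha> by (auto simp: M'_def M_def in_keys_iff lookup_minus subset_iff)
      qed
      show "(\<lambda>\<alpha>. \<alpha> + Poly_Mapping.single a 1) ` M (insert a A) (n - 1) \<subseteq> M'"
      proof clarify
        fix \<alpha> assume \<alpha>: "\<alpha> \<in> M (insert a A) (n - 1)"
        have "Poly_Mapping.keys (\<alpha> + Poly_Mapping.single a 1) \<subseteq> insert a A"
          using keys_add[of \<alpha> "Poly_Mapping.single a 1"] \<alpha> by (auto simp: M_def)
        then show "\<alpha> + Poly_Mapping.single a 1 \<in> M'"
          using \<alpha> False by (simp add: M'_def M_def lookup_add monom_degree_add)
      qed
    qed simp
    then show ?thesis using False by (simp add: bij_betw_same_card)
  qed
  ultimately show ?thesis by simp
qed

text \<open>Each new variable divides the generating function by \<open>1 - fps_X\<close>; the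
  recursion above is this identity read off coefficientwise.\<close>

lemma fps_monomial_count:
  fixes A :: "'n::finite set"
  shows "Abs_fps (\<lambda>n. real (card {\<alpha> :: 'n \<Rightarrow>\<^sub>0 nat. Poly_Mapping.keys \<alpha> \<subseteq> A \<and> monom_degree \<alpha> = n}))
    * (1 - fps_X) ^ card A = 1"
proof (induction A rule: finite_induct[OF finite])
  case 1
  have "{\<alpha> :: 'n \<Rightarrow>\<^sub>0 nat. Poly_Mapping.keys \<alpha> \<subseteq> {} \<and> monom_degree \<alpha> = n} = (if n = 0 then {0} else {})" for n
    by auto
  then show ?case
    by (intro fps_ext) simp
next
  case (2 a A)
  let ?G = "\<lambda>B. Abs_fps (\<lambda>n. real (card {\<alpha> :: 'n \<Rightarrow>\<^sub>0 nat. Poly_Mapping.keys \<alpha> \<subseteq> B \<and> monom_degree \<alpha> = n}))"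
  have "?G (insert a A) * (1 - fps_X) = ?G A"
    by (rule fps_ext) (use card_monomials_insert[OF 2(2)] in \<open>simp add: right_diff_distrib fps_X_mult_right_nth\<close>)
  then show ?case
    using 2 by (simp add: mult.assoc[symmetric])
qed

text \<open>For a set \<open>S\<close> of forms, the coefficients are the dimensions of the graded
  pieces of the quotient ring, written as differences to avoid quotients.\<close>

definition hilbert_series :: "'n::finite real_mpoly set \<Rightarrow> real fps" where
  "hilbert_series S = Abs_fps (\<lambda>n. real (dim (homogeneous_polys n :: 'n real_mpoly set))
     - real (dim (ideal_gen S \<inter> homogeneous_polys n)))"

lemma hilbert_series_empty:
  "hilbert_series ({} :: 'n::finite real_mpoly set) * (1 - fps_X) ^ CARD('n) = 1"
proof -
  have "ideal_gen {} \<inter> homogeneous_polys n = ({0} :: 'n real_mpoly set)" for n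
    using subspace_0[OF subspace_homogeneous_polys, of n] by (auto simp: ideal_gen_empty)
  then have "dim (ideal_gen {} \<inter> homogeneous_polys n :: 'n real_mpoly set) = 0" for n
    using dim_le_card[of "{0 :: 'n real_mpoly}" "{}"] by simp
  moreover have "dim (homogeneous_polys n :: 'n real_mpoly set) = card {\<alpha> :: 'n \<Rightarrow>\<^sub>0 nat. monom_degree \<alpha> = n}" for n
    unfolding homogeneous_polys_def by (rule dim_keys_within[OF finite_monom_degree_eq])
  ultimately show ?thesis
    using fps_monomial_count[of "UNIV :: 'n set"] by (simp add: hilbert_series_def)
qed

text \<open>With \<open>h\<close> the old coefficients, regularity makes the new one
  \<open>h n - h (n - d)\<close>. For \<open>n < d\<close> the ideal is unchanged in degree
  \<open>n\<close>, and \<open>fps_X ^ d\<close> does not reach that coefficient.\<close>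

lemma hilbert_series_insert:
  assumes hom: "\<And>s. s \<in> S \<Longrightarrow> \<exists>d. s \<in> homogeneous_polys d" and p: "p \<in> homogeneous_polys d"
    and reg: "\<And>q. q * p \<in> ideal_gen S \<Longrightarrow> q \<in> ideal_gen S"
  shows "hilbert_series (insert p S) = hilbert_series S * (1 - fps_X ^ d)"
proof (rule fps_ext)
  fix n
  show "fps_nth (hilbert_series (insert p S)) n = fps_nth (hilbert_series S * (1 - fps_X ^ d)) n"
  proof (cases "d \<le> n")
    case True
    from dim_ideal_gen_insert_homogeneous[OF hom p True reg] True show ?thesis
      by (simp add: hilbert_series_def right_diff_distrib fps_X_power_mult_right_nth)
  next
    case False
    then show ?thesis
      by (simp add: hilbert_series_def right_diff_distrib fps_X_power_mult_right_nth
          ideal_gen_insert_homogeneous_less[OF hom p])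
  qed
qed

lemma hilbert_series_regular_sequence:
  fixes p :: "nat \<Rightarrow> 'n::finite real_mpoly"
  assumes hom: "\<And>i. i \<in> {1..k} \<Longrightarrow> p i \<in> homogeneous_polys (d i)"
    and reg: "\<And>i q. i \<in> {1..k} \<Longrightarrow> q * p i \<in> ideal_gen (p ` {1..<i}) \<Longrightarrow> q \<in> ideal_gen (p ` {1..<i})"
  shows "hilbert_series (p ` {1..k}) = hilbert_series ({} :: 'n real_mpoly set) * (\<Prod>i=1..k. 1 - fps_X ^ d i)"
  using assms
proof (induction k)
  case (Suc k)
  have "hilbert_series (insert (p (Suc k)) (p ` {1..k})) = hilbert_series (p ` {1..k}) * (1 - fps_X ^ d (Suc k))"
  proof (rule hilbert_series_insert)
    show "\<exists>d. s \<in> homogeneous_polys d" if "s \<in> p ` {1..k}" for s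
      using that Suc.prems(1) by fastforce
    show "p (Suc k) \<in> homogeneous_polys (d (Suc k))" using Suc.prems(1) by simp
    show "q \<in> ideal_gen (p ` {1..k})" if "q * p (Suc k) \<in> ideal_gen (p ` {1..k})" for q
      using Suc.prems(2)[of "Suc k" q] that by (simp add: atLeastLessThanSuc_atLeastAtMost)
  qed
  moreover have "hilbert_series (p ` {1..k}) = hilbert_series ({} :: 'n real_mpoly set) * (\<Prod>i=1..k. 1 - fps_X ^ d i)"
    by (rule Suc.IH) (use Suc.prems in auto)
  moreover have "{1..Suc k} = insert (Suc k) {1..k}" by auto
  moreover have "(\<Prod>i\<in>insert (Suc k) {1..k}. 1 - fps_X ^ d i) = (1 - fps_X ^ d (Suc k)) * (\<Prod>i=1..k. 1 - fps_X ^ d i :: real fps)"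
    by (rule prod.insert) auto
  ultimately show ?case
    by (simp only: image_insert mult_ac)
qed simp

text \<open>This takes the place of evaluation at 1: partial sums of series with nonnegative
  coefficients are submultiplicative. Nonnegativity of the product is carried along because the
  induction step uses it.\<close>

lemma fps_prod_partial_sums_le:
  fixes f :: "'i \<Rightarrow> real fps"
  assumes "finite I" "\<And>i n. i \<in> I \<Longrightarrow> 0 \<le> fps_nth (f i) n"
    and "\<And>i n. i \<in> I \<Longrightarrow> (\<Sum>m<n. fps_nth (f i) m) \<le> c i"
  shows "(\<forall>n. 0 \<le> fps_nth (\<Prod>i\<in>I. f i) n) \<and> (\<forall>n. (\<Sum>m<n. fps_nth (\<Prod>i\<in>I. f i) m) \<le> (\<Prod>i\<in>I. c i))"
  using assms
proof (induction I)
  case empty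
  then show ?case by (auto simp: sum.delta)
next
  case (insert i I)
  define g where "g = (\<Prod>i\<in>I. f i)"
  have g: "0 \<le> fps_nth g n" "(\<Sum>m<n. fps_nth g m) \<le> (\<Prod>i\<in>I. c i)" for n
    using insert unfolding g_def by auto
  have f: "0 \<le> fps_nth (f i) n" "(\<Sum>m<n. fps_nth (f i) m) \<le> c i" for n
    using insert.prems by auto
  have "(\<Sum>m<n. fps_nth (f i * g) m) \<le> c i * (\<Prod>i\<in>I. c i)" for n
  proof -
    have "(\<Sum>m<n. fps_nth (f i * g) m) = (\<Sum>(j, l)\<in>{(j, l). j + l < n}. fps_nth (f i) j * fps_nth g l)"
      by (simp add: fps_mult_nth sum.triangle_reindex atLeast0AtMost)
    \<comment> \<open>The triangle \<open>j + l < n\<close> lies in the square, and the extra terms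
      are nonnegative.\<close>
    also have "\<dots> \<le> (\<Sum>(j, l)\<in>{..<n} \<times> {..<n}. fps_nth (f i) j * fps_nth g l)"
      by (rule sum_mono2) (auto simp: f g)
    also have "\<dots> = (\<Sum>m<n. fps_nth (f i) m) * (\<Sum>m<n. fps_nth g m)"
      by (simp add: sum_product sum.cartesian_product)
    also have "\<dots> \<le> c i * (\<Prod>i\<in>I. c i)"
      \<comment> \<open>\<open>f(2)[of 0]\<close> bounds the empty sum and thus gives
        \<open>0 \<le> c i\<close>.\<close>
      using f[of n] f(2)[of 0] g[of n] by (intro mult_mono) (auto intro: sum_nonneg f g)
    finally show ?thesis .
  qed
  moreover have "0 \<le> fps_nth (f i * g) n" for n
    by (simp add: fps_mult_nth f g sum_nonneg)
  ultimately show ?case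
    using insert.hyps by (simp add: g_def)
qed

text \<open>Every \<open>1 - fps_X ^ d i\<close> is \<open>1 - fps_X\<close> times a geometric sum.
  With as many forms as variables, the factors \<open>1 - fps_X\<close> exactly cancel the series of
  the full polynomial ring.\<close>

lemma hilbert_series_complete_intersection:
  fixes p :: "nat \<Rightarrow> 'n::finite real_mpoly"
  assumes "\<And>i. i \<in> {1..CARD('n)} \<Longrightarrow> p i \<in> homogeneous_polys (d i)"
    and "\<And>i q. i \<in> {1..CARD('n)} \<Longrightarrow> q * p i \<in> ideal_gen (p ` {1..<i}) \<Longrightarrow> q \<in> ideal_gen (p ` {1..<i})"
  shows "hilbert_series (p ` {1..CARD('n)}) = (\<Prod>i=1..CARD('n). \<Sum>j<d i. fps_X ^ j)"
proof -
  have "hilbert_series (p ` {1..CARD('n)}) = hilbert_series ({} :: 'n real_mpoly set) * (\<Prod>i=1..CARD('n). (1 - fps_X) * (\<Sum>j<d i. fps_X ^ j))"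
    using hilbert_series_regular_sequence[of "CARD('n)" p d, OF assms] by (simp add: one_diff_power_eq)
  also have "\<dots> = hilbert_series ({} :: 'n real_mpoly set) * (1 - fps_X) ^ CARD('n) * (\<Prod>i=1..CARD('n). \<Sum>j<d i. fps_X ^ j)"
    by (simp only: prod.distrib prod_constant card_atLeastAtMost diff_Suc_1 Suc_eq_plus1[symmetric] mult.assoc)
  finally show ?thesis by (simp only: hilbert_series_empty mult_1_left)
qed

text \<open>The geometric factor for \<open>d i\<close> has \<open>d i\<close> coefficients equal to
  1 and the rest 0, which bounds its partial sums by \<open>d i\<close>.\<close>

lemma hilbert_series_partial_sums_le:
  fixes p :: "nat \<Rightarrow> 'n::finite real_mpoly"
  assumes "\<And>i. i \<in> {1..CARD('n)} \<Longrightarrow> p i \<in> homogeneous_polys (d i)"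
    and "\<And>i q. i \<in> {1..CARD('n)} \<Longrightarrow> q * p i \<in> ideal_gen (p ` {1..<i}) \<Longrightarrow> q \<in> ideal_gen (p ` {1..<i})"
  shows "(\<Sum>m<n. fps_nth (hilbert_series (p ` {1..CARD('n)})) m) \<le> real (\<Prod>i=1..CARD('n). d i)"
proof -
  have nth: "fps_nth (\<Sum>j<e. fps_X ^ j :: real fps) m = (if m < e then 1 else 0)" for e m
    by (simp add: fps_sum_nth)
  have "(\<Sum>m<n. fps_nth (\<Sum>j<e. fps_X ^ j :: real fps) m) \<le> real e" for e n
  proof -
    have "(\<Sum>m<n. fps_nth (\<Sum>j<e. fps_X ^ j :: real fps) m) = real (card ({..<n} \<inter> {..<e}))"
      unfolding nth by (simp add: sum.If_cases lessThan_def)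
    also have "\<dots> \<le> real e"
      using card_mono[of "{..<e}" "{..<n} \<inter> {..<e}"] by simp
    finally show ?thesis .
  qed
  then have "(\<Sum>m<n. fps_nth (\<Prod>i=1..CARD('n). \<Sum>j<d i. fps_X ^ j) m) \<le> (\<Prod>i=1..CARD('n). real (d i))"
    using fps_prod_partial_sums_le[of "{1..CARD('n)}" "\<lambda>i. \<Sum>j<d i. fps_X ^ j" "\<lambda>i. real (d i)"]
    by (simp add: nth)
  moreover have "hilbert_series (p ` {1..CARD('n)}) = (\<Prod>i=1..CARD('n). \<Sum>j<d i. fps_X ^ j)"
    by (rule hilbert_series_complete_intersection[of p d, OF assms])
  ultimately show ?thesis by (simp only: of_nat_prod)
qed

section \<open>Values of polynomials on a finite set\<close>

text \<open>A common index set is wanted for sums of polynomials, whose keys may cancel.\<close>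

lemma mpoly_eval_eq_sum:
  assumes "finite K" "Poly_Mapping.keys p \<subseteq> K"
  shows "mpoly_eval p y = (\<Sum>\<alpha>\<in>K. Poly_Mapping.lookup p \<alpha> * (\<Prod>i\<in>UNIV. (y $ i) ^ Poly_Mapping.lookup \<alpha> i))"
  unfolding mpoly_eval_def
  by (rule sum.mono_neutral_left) (use assms in \<open>auto simp: in_keys_iff\<close>)

lemma mpoly_eval_zero [simp]: "mpoly_eval 0 y = 0"
  by (simp add: mpoly_eval_def)

lemma mpoly_eval_single [simp]:
  "mpoly_eval (Poly_Mapping.single \<alpha> c) y = c * (\<Prod>i\<in>UNIV. (y $ i) ^ Poly_Mapping.lookup \<alpha> i)"
  by (subst mpoly_eval_eq_sum[where K = "{\<alpha>}"]) auto

lemma mpoly_eval_add [simp]: "mpoly_eval (p + q) y = mpoly_eval p y + mpoly_eval q y"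
proof -
  let ?K = "Poly_Mapping.keys p \<union> Poly_Mapping.keys q"
  have "Poly_Mapping.keys (p + q) \<subseteq> ?K" by (rule keys_add)
  then show ?thesis
    by (simp add: mpoly_eval_eq_sum[where K = ?K] lookup_add distrib_right sum.distrib)
qed

lemma mpoly_eval_mult [simp]: "mpoly_eval (p * q) y = mpoly_eval p y * mpoly_eval q y"
proof (induction p rule: poly_mapping_add_induct)
  case (single \<alpha> a)
  show ?case
  proof (induction q rule: poly_mapping_add_induct)
    case (single \<beta> b)
    then show ?case
      by (simp add: mult_single lookup_add power_add prod.distrib)
  qed (simp_all add: distrib_left del: mpoly_eval_single)
qed (simp_all add: distrib_right)

lemma mpoly_eval_scaleR [simp]: "mpoly_eval (r *\<^sub>R p) y = r * mpoly_eval p y"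
  by (simp add: scaleR_eq_single_mult)

lemma mpoly_eval_uminus [simp]: "mpoly_eval (- p) y = - mpoly_eval p y"
  using mpoly_eval_scaleR[of "-1" p y] by simp

lemma mpoly_eval_diff [simp]: "mpoly_eval (p - q) y = mpoly_eval p y - mpoly_eval q y"
  using mpoly_eval_add[of p "- q" y] by simp

lemma mpoly_eval_sum [simp]: "mpoly_eval (\<Sum>i\<in>I. p i) y = (\<Sum>i\<in>I. mpoly_eval (p i) y)"
  by (induction I rule: infinite_finite_induct) simp_all

lemma prod_power_single:
  fixes y :: "real ^ 'n::finite"
  shows "(\<Prod>k\<in>UNIV. (y $ k) ^ Poly_Mapping.lookup (Poly_Mapping.single j (1::nat)) k) = y $ j"
proof -
  have "(\<Prod>k\<in>UNIV. (y $ k) ^ Poly_Mapping.lookup (Poly_Mapping.single j (1::nat)) k) =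
    (\<Prod>k\<in>UNIV. if k = j then y $ j else 1)"
    by (rule prod.cong) (auto simp: lookup_single when_def)
  then show ?thesis by simp
qed

section \<open>Degree filtration and leading forms\<close>

lemma monom_degree_le_mpoly_degree:
  "\<alpha> \<in> Poly_Mapping.keys p \<Longrightarrow> monom_degree \<alpha> \<le> mpoly_degree p"
  unfolding mpoly_degree_def by (rule Max_ge) auto

lemma polys_below_Suc_mpoly_degree: "p \<in> polys_below (Suc (mpoly_degree p))"
  using monom_degree_le_mpoly_degree by (auto simp: polys_below_def keys_within_def less_Suc_eq_le)

lemma polys_below_mono: "m \<le> n \<Longrightarrow> polys_below m \<subseteq> polys_below n"
  by (auto simp: polys_below_def keys_within_def)

lemma top_hom_eq_hom_part: "top_hom p = hom_part (mpoly_degree p) p"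
proof (rule poly_mapping_eqI)
  fix \<alpha>
  have "Poly_Mapping.lookup (top_hom p) \<alpha> =
    (\<Sum>\<beta> | \<beta> \<in> Poly_Mapping.keys p \<and> monom_degree \<beta> = mpoly_degree p.
      if \<beta> = \<alpha> then Poly_Mapping.lookup p \<alpha> else 0)"
    unfolding top_hom_def lookup_sum by (rule sum.cong) (auto simp: lookup_single when_def)
  also have "\<dots> = Poly_Mapping.lookup (hom_part (mpoly_degree p) p) \<alpha>"
    by (auto simp: lookup_restrict_keys in_keys_iff)
  finally show "Poly_Mapping.lookup (top_hom p) \<alpha> = Poly_Mapping.lookup (hom_part (mpoly_degree p) p) \<alpha>" .
qed

lemma top_hom_homogeneous: "top_hom p \<in> homogeneous_polys (mpoly_degree p)"
  unfolding top_hom_eq_hom_part homogeneous_polys_def by (rule restrict_keys_in_keys_within)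

lemma diff_top_hom_below: "p - top_hom p \<in> polys_below (mpoly_degree p)"
proof -
  have "monom_degree \<alpha> < mpoly_degree p" if "\<alpha> \<in> Poly_Mapping.keys (p - top_hom p)" for \<alpha>
    using that monom_degree_le_mpoly_degree[of \<alpha> p]
    by (cases "monom_degree \<alpha> = mpoly_degree p")
      (auto simp: in_keys_iff lookup_minus top_hom_eq_hom_part lookup_restrict_keys)
  then show ?thesis by (auto simp: polys_below_def keys_within_def)
qed

text \<open>Using finitely supported functions on points puts the value vectors for all
  \<open>F\<close> in one vector space; for finite \<open>F\<close>, \<open>keys_within F\<close>
  has dimension \<open>card F\<close>.\<close>

definition eval_on :: "(real ^ 'n) set \<Rightarrow> 'n::finite real_mpoly \<Rightarrow> (real ^ 'n) \<Rightarrow>\<^sub>0 real" where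
  "eval_on F p = (\<Sum>y\<in>F. Poly_Mapping.single y (mpoly_eval p y))"

lemma linear_eval_on: "linear (eval_on F)"
  by (rule linearI)
    (simp_all add: eval_on_def single_add sum.distrib scaleR_sum_right scaleR_single)

lemma eval_on_cong: "(\<And>y. y \<in> F \<Longrightarrow> mpoly_eval p y = mpoly_eval q y) \<Longrightarrow> eval_on F p = eval_on F q"
  unfolding eval_on_def by (rule sum.cong) auto

lemma eval_on_in_keys_within: "eval_on F p \<in> keys_within F"
proof (cases "finite F")
  case True
  then show ?thesis
    unfolding eval_on_def by (intro subspace_sum[OF subspace_keys_within]) (simp add: keys_within_def)
qed (simp add: eval_on_def keys_within_def)

text \<open>Interpolation by a product of linear factors, one per point of \<open>G\<close>: the
  factor uses a coordinate where that point differs from \<open>y\<close>, and is scaled to be 1 at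
  \<open>y\<close>.\<close>

lemma ex_mpoly_separating:
  fixes y :: "real ^ 'n::finite"
  assumes "finite G" "y \<notin> G"
  shows "\<exists>p. mpoly_eval p y = 1 \<and> (\<forall>z\<in>G. mpoly_eval p z = 0)"
  using assms
proof (induction G)
  case empty
  have "mpoly_eval 1 y = 1"
    using mpoly_eval_single[of 0 1 y] by (simp del: mpoly_eval_single)
  then show ?case by blast
next
  case (insert z G)
  then obtain p where p: "mpoly_eval p y = 1" "\<forall>z\<in>G. mpoly_eval p z = 0" by auto
  from insert.prems obtain i where i: "y $ i \<noteq> z $ i" by (auto simp: vec_eq_iff)
  define l :: "'n real_mpoly" where
    "l = Poly_Mapping.single (Poly_Mapping.single i 1) 1 - Poly_Mapping.single 0 (z $ i)"
  have l: "mpoly_eval l w = w $ i - z $ i" for w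
    using prod_power_single[of w i] by (simp add: l_def)
  have "mpoly_eval ((1 / (y $ i - z $ i)) *\<^sub>R (l * p)) y = 1"
    using i p by (simp add: l)
  moreover have "mpoly_eval ((1 / (y $ i - z $ i)) *\<^sub>R (l * p)) w = 0" if "w \<in> insert z G" for w
    using that p by (auto simp: l)
  ultimately show ?case by blast
qed

text \<open>Write \<open>q\<close> as a combination of the \<open>p i\<close> whose coefficients are
  forms of degree \<open>n - d i\<close>. Replacing \<open>p i\<close> by \<open>r i\<close> keeps
  the values on \<open>F\<close> and pushes the degree below \<open>n\<close>. The induction splits
  off one generator at a time.\<close>

lemma eval_on_ideal_gen:
  fixes p :: "nat \<Rightarrow> 'n::finite real_mpoly"
  assumes "\<And>i. i \<in> {1..k} \<Longrightarrow> p i \<in> homogeneous_polys (d i)"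
    and "\<And>i. i \<in> {1..k} \<Longrightarrow> r i \<in> polys_below (d i)"
    and "\<And>i y. i \<in> {1..k} \<Longrightarrow> y \<in> F \<Longrightarrow> mpoly_eval (p i) y = mpoly_eval (r i) y"
    and "q \<in> ideal_gen (p ` {1..k}) \<inter> homogeneous_polys n"
  shows "eval_on F q \<in> eval_on F ` polys_below n"
  using assms
proof (induction k arbitrary: q)
  case 0
  then have "q = 0" by (simp add: ideal_gen_empty)
  then show ?case using subspace_0[OF subspace_polys_below] by blast
next
  case (Suc k)
  define S where "S = p ` {1..k}"
  have hom: "\<exists>d. s \<in> homogeneous_polys d" if "s \<in> S" for s
    using that Suc.prems(1) unfolding S_def by fastforce
  have pk: "p (Suc k) \<in> homogeneous_polys (d (Suc k))" using Suc.prems(1) by simp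
  have IH: "eval_on F a \<in> eval_on F ` polys_below n" if "a \<in> ideal_gen S \<inter> homogeneous_polys n" for a
    by (rule Suc.IH) (use Suc.prems that in \<open>auto simp: S_def\<close>)
  have "p ` {1..Suc k} = insert (p (Suc k)) S"
    unfolding S_def by (simp add: atLeastAtMostSuc_conv)
  then have q: "q \<in> ideal_gen (insert (p (Suc k)) S) \<inter> homogeneous_polys n"
    using Suc.prems(4) by metis
  show ?case
  proof (cases "d (Suc k) \<le> n")
    case True
    have "ideal_gen (insert (p (Suc k)) S) \<inter> homogeneous_polys n =
      {a + h * p (Suc k) | a h. a \<in> ideal_gen S \<inter> homogeneous_polys n \<and> h \<in> homogeneous_polys (n - d (Suc k))}"
      by (rule ideal_gen_insert_homogeneous[OF hom pk True])
    with q obtain a h where ah: "q = a + h * p (Suc k)" "a \<in> ideal_gen S \<inter> homogeneous_polys n"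
      "h \<in> homogeneous_polys (n - d (Suc k))"
      by blast
    have "eval_on F (h * p (Suc k)) = eval_on F (h * r (Suc k))"
      using Suc.prems(3) by (intro eval_on_cong) simp
    moreover have "h * r (Suc k) \<in> polys_below n"
      using homogeneous_mult_polys_below[OF ah(3) Suc.prems(2)[of "Suc k"]] True by simp
    ultimately have "eval_on F (h * p (Suc k)) \<in> eval_on F ` polys_below n" by blast
    moreover have "subspace (eval_on F ` polys_below n)"
      by (rule linear_subspace_image[OF linear_eval_on subspace_polys_below])
    ultimately show ?thesis
      unfolding ah(1) linear_add[OF linear_eval_on] using IH[OF ah(2)] subspace_add by blast
  next
    case False
    then have "q \<in> ideal_gen S \<inter> homogeneous_polys n"
      using q ideal_gen_insert_homogeneous_less[of S "p (Suc k)" "d (Suc k)" n, OF hom pk] by simp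
    then show ?thesis by (rule IH)
  qed
qed

lemma polys_below_Suc:
  "polys_below (Suc n) = {b + h | b h. b \<in> polys_below n \<and> h \<in> homogeneous_polys n}"
proof (intro equalityI subsetI)
  fix p assume p: "p \<in> polys_below (Suc n)"
  have "p = restrict_keys {\<alpha>. monom_degree \<alpha> < n} p + hom_part n p"
  proof (rule poly_mapping_eqI)
    fix \<alpha>
    have "Poly_Mapping.lookup p \<alpha> = 0" if "\<not> monom_degree \<alpha> \<le> n"
      using p that by (auto simp: polys_below_def keys_within_def in_keys_iff subset_iff less_Suc_eq_le)
    then show "Poly_Mapping.lookup p \<alpha> = Poly_Mapping.lookup (restrict_keys {\<alpha>. monom_degree \<alpha> < n} p + hom_part n p) \<alpha>"
      by (auto simp: lookup_add lookup_restrict_keys)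
  qed
  then show "p \<in> {b + h | b h. b \<in> polys_below n \<and> h \<in> homogeneous_polys n}"
    unfolding polys_below_def homogeneous_polys_def using restrict_keys_in_keys_within by blast
next
  fix p assume "p \<in> {b + h | b h. b \<in> polys_below n \<and> h \<in> homogeneous_polys n}"
  then obtain b h where bh: "p = b + h" "b \<in> polys_below n" "h \<in> homogeneous_polys n" by blast
  then have "b \<in> polys_below (Suc n)" "h \<in> polys_below (Suc n)"
    by (auto simp: polys_below_def homogeneous_polys_def keys_within_def)
  then show "p \<in> polys_below (Suc n)"
    unfolding bh(1) by (rule subspace_add[OF subspace_polys_below])
qed

text \<open>Passing to the next level adds the values of forms of degree \<open>n\<close>. Those in
  the ideal of \<open>S\<close> contribute nothing new, so the increase is at most the codimension
  of the ideal in that degree.\<close>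

lemma dim_eval_on_polys_below_Suc:
  fixes S :: "'n::finite real_mpoly set"
  assumes "finite F"
    and "\<And>q. q \<in> ideal_gen S \<inter> homogeneous_polys n \<Longrightarrow> eval_on F q \<in> eval_on F ` polys_below n"
  shows "real (dim (eval_on F ` (polys_below (Suc n) :: 'n real_mpoly set)))
    \<le> real (dim (eval_on F ` (polys_below n :: 'n real_mpoly set))) + fps_nth (hilbert_series S) n"
proof -
  let ?U = "eval_on F ` (polys_below n :: 'n real_mpoly set)" and ?V = "homogeneous_polys n :: 'n real_mpoly set"
  let ?N = "{h \<in> ?V. eval_on F h \<in> ?U}"
  obtain W :: "'n real_mpoly set" where W: "finite W" "?V \<subseteq> span W"
    by (rule homogeneous_polys_finite_span)
  have U: "subspace ?U"
    by (rule linear_subspace_image[OF linear_eval_on subspace_polys_below])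
  have "?U \<subseteq> keys_within F" using eval_on_in_keys_within by blast
  then have Uspan: "?U \<subseteq> span ((\<lambda>y. Poly_Mapping.single y 1) ` F)"
    using keys_within_span by blast
  have "dim {u + eval_on F h | u h. u \<in> ?U \<and> h \<in> ?V} + dim ?N = dim ?U + dim ?V"
    by (rule dim_sum_linear_image[OF linear_eval_on U subspace_homogeneous_polys Uspan _ W(2,1)])
      (use assms(1) in simp)
  moreover have "{u + eval_on F h | u h. u \<in> ?U \<and> h \<in> ?V} = eval_on F ` polys_below (Suc n)"
    unfolding polys_below_Suc by (force simp: linear_add[OF linear_eval_on])
  \<comment> \<open>Forms outside the ideal may also lie in \<open>?N\<close>; this is why only an
    inequality results.\<close>
  moreover have "dim (ideal_gen S \<inter> ?V) \<le> dim ?N"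
    by (rule dim_mono_of_finite_span[OF _ _ W(1)]) (use assms(2) W(2) in auto)
  ultimately show ?thesis by (simp add: hilbert_series_def)
qed

text \<open>The lower-order terms are moved into \<open>r i\<close>, so only leading forms enter the
  Hilbert series. The value spaces grow from 0 to all functions on \<open>F\<close>, and the total
  growth is a partial sum of that series.\<close>

lemma card_common_zeros_le:
  fixes p :: "nat \<Rightarrow> 'n::finite real_mpoly"
  assumes "finite F"
    and hom: "\<And>i. i \<in> {1..CARD('n)} \<Longrightarrow> p i \<in> homogeneous_polys (d i)"
    and reg: "\<And>i q. i \<in> {1..CARD('n)} \<Longrightarrow> q * p i \<in> ideal_gen (p ` {1..<i}) \<Longrightarrow> q \<in> ideal_gen (p ` {1..<i})"
    and low: "\<And>i. i \<in> {1..CARD('n)} \<Longrightarrow> r i \<in> polys_below (d i)"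
    and zero: "\<And>i y. i \<in> {1..CARD('n)} \<Longrightarrow> y \<in> F \<Longrightarrow> mpoly_eval (p i) y = mpoly_eval (r i) y"
  shows "card F \<le> (\<Prod>i=1..CARD('n). d i)"
proof -
  let ?U = "\<lambda>n. eval_on F ` (polys_below n :: 'n real_mpoly set)"
  define S where "S = p ` {1..CARD('n)}"
  have step: "real (dim (?U (Suc n))) \<le> real (dim (?U n)) + fps_nth (hilbert_series S) n" for n
    unfolding S_def
    by (intro dim_eval_on_polys_below_Suc[OF assms(1)] eval_on_ideal_gen[of "CARD('n)" p d r F, OF hom low zero])
  have bound: "real (dim (?U n)) \<le> (\<Sum>m<n. fps_nth (hilbert_series S) m)" for n
  proof (induction n)
    case 0
    have "?U 0 \<subseteq> span {}"
      by (auto simp: polys_below_def keys_within_def linear_0[OF linear_eval_on])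
    then have "dim (?U 0) = 0" using dim_le_card[of "?U 0" "{}"] by simp
    then show ?case by simp
  next
    case (Suc n)
    then show ?case using step[of n] by simp
  qed
  have "\<exists>p. mpoly_eval p y = 1 \<and> (\<forall>z\<in>F - {y}. mpoly_eval p z = 0)" for y
    by (rule ex_mpoly_separating) (use assms(1) in auto)
  then obtain e where e: "mpoly_eval (e y) y = 1" "\<And>z. z \<in> F - {y} \<Longrightarrow> mpoly_eval (e y) z = 0" for y
    by metis
  \<comment> \<open>This level exceeds the degrees of all interpolating polynomials at once, so it
    contains every unit vector; the successor accounts for the strict bound in
    \<open>polys_below\<close>.\<close>
  define n where "n = Suc (\<Sum>y\<in>F. mpoly_degree (e y))"
  have "(\<lambda>y. Poly_Mapping.single y 1) ` F \<subseteq> ?U n"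
  proof
    fix s :: "(real ^ 'n) \<Rightarrow>\<^sub>0 real" assume "s \<in> (\<lambda>y. Poly_Mapping.single y 1) ` F"
    then obtain y where y: "y \<in> F" "s = Poly_Mapping.single y 1" by blast
    have "mpoly_degree (e y) \<le> (\<Sum>y\<in>F. mpoly_degree (e y))"
      using y assms(1) by (intro member_le_sum) auto
    then have "e y \<in> polys_below n"
      using polys_below_Suc_mpoly_degree[of "e y"] polys_below_mono[of "Suc (mpoly_degree (e y))" n]
      by (auto simp: n_def)
    moreover have "eval_on F (e y) = s"
    proof -
      have "eval_on F (e y) = (\<Sum>z\<in>F. if z = y then Poly_Mapping.single y 1 else 0)"
        unfolding eval_on_def by (rule sum.cong) (use e in auto)
      then show ?thesis using y assms(1) by simp
    qed
    ultimately show "s \<in> ?U n" by blast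
  qed
  moreover have "?U n \<subseteq> span ((\<lambda>y. Poly_Mapping.single y 1) ` F)"
    using eval_on_in_keys_within keys_within_span by blast
  ultimately have "card ((\<lambda>y. Poly_Mapping.single y (1::real)) ` F) \<le> dim (?U n)"
    by (rule independent_card_le_dim_of_finite_span[OF independent_single_one[OF assms(1)]])
      (use assms(1) in simp)
  then have "card F \<le> dim (?U n)" by (simp add: card_single_one)
  also have "real (dim (?U n)) \<le> real (\<Prod>i=1..CARD('n). d i)"
  proof -
    have "(\<Sum>m<n. fps_nth (hilbert_series S) m) \<le> real (\<Prod>i=1..CARD('n). d i)"
      unfolding S_def by (rule hilbert_series_partial_sums_le[OF hom reg])
    then show ?thesis using bound[of n] by linarith
  qed
  finally show ?thesis by (simp only: of_nat_le_iff)
qed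

section \<open>From the gradient equation to common zeros of polynomials\<close>

theorem proposition2p12:
  fixes c :: "(real ^ 'n::finite) \<times> (real ^ 'n) \<Rightarrow> real"
    and x0 :: "real ^ 'n"
    and P :: "nat \<Rightarrow> 'n real_mpoly"
    and u :: "nat \<Rightarrow> real ^ 'n"
    and L :: "real ^ 'n \<Rightarrow> real ^ 'n"
    and b :: "real ^ 'n"
    and A :: "real ^ 'n \<Rightarrow> real ^ 'n"
    and S0 :: "(real ^ 'n) set"
  assumes "\<And>y. (\<lambda>x. c (x, y)) differentiable (at x0)"
    and "\<And>y. grad_fst c x0 y = (\<Sum>i=1..CARD('n). mpoly_eval (P i) y *\<^sub>R u i)"
    and "inj_on u {1..CARD('n)}"
    and "independent (u ` {1..CARD('n)})"
    and "span (u ` {1..CARD('n)}) = UNIV"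
    and "\<And>i. i \<in> {1..CARD('n)} \<Longrightarrow> mpoly_degree (P i) \<ge> 2"
    and "complete_at_infinity CARD('n) P"
    and "linear L"
    and "A = (\<lambda>y. L y + b)"
    and "S0 = {y. grad_fst c x0 y = A y}"
  shows "finite S0 \<and> card S0 \<le> (\<Prod>i=1..CARD('n). mpoly_degree (P i))"
proof -
  let ?I = "{1..CARD('n)}" and ?B = "u ` {1..CARD('n)}"
  \<comment> \<open>Coordinate functionals of the basis \<open>u\<close>: applied to the gradient,
    \<open>\<phi> i\<close> isolates the value of \<open>P i\<close> for \<open>i\<close> in
    \<open>?I\<close>.\<close>
  have "\<exists>\<phi> :: real ^ 'n \<Rightarrow> real. linear \<phi> \<and> (\<forall>v\<in>?B. \<phi> v = (if v = u i then 1 else 0))" for i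
    by (rule linear_independent_extend[OF assms(4)])
  then obtain \<phi> :: "nat \<Rightarrow> real ^ 'n \<Rightarrow> real" where \<phi>: "\<And>i. linear (\<phi> i)"
    "\<And>i v. v \<in> ?B \<Longrightarrow> \<phi> i v = (if v = u i then 1 else 0)"
    by metis
  \<comment> \<open>The polynomial of degree at most one for the coordinate \<open>i\<close> of
    \<open>A\<close>: \<open>b\<close> gives the constant term, the images of the unit vectors under
    \<open>L\<close> the linear coefficients.\<close>
  define a :: "nat \<Rightarrow> 'n real_mpoly" where
    "a i = Poly_Mapping.single 0 (\<phi> i b)
      + (\<Sum>j\<in>UNIV. Poly_Mapping.single (Poly_Mapping.single j 1) (\<phi> i (L (axis j 1))))" for i
  have a_eval: "mpoly_eval (a i) y = \<phi> i (A y)" for i y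
  proof -
    have "mpoly_eval (a i) y = \<phi> i b + (\<Sum>j\<in>UNIV. y $ j * \<phi> i (L (axis j 1)))"
      using prod_power_single[of y] by (simp add: a_def mult.commute)
    also have "(\<Sum>j\<in>UNIV. y $ j * \<phi> i (L (axis j 1))) = \<phi> i (L (\<Sum>j\<in>UNIV. y $ j *\<^sub>R axis j 1))"
      by (simp add: linear_sum[OF \<open>linear L\<close>] linear_sum[OF \<phi>(1)] linear_scale[OF \<open>linear L\<close>]
          linear_scale[OF \<phi>(1)])
    also have "(\<Sum>j\<in>UNIV. y $ j *\<^sub>R axis j 1) = y"
      using basis_expansion[of y] by (simp add: scalar_mult_eq_scaleR)
    finally show ?thesis
      by (simp add: assms(9) linear_add[OF \<phi>(1)])
  qed
  have a_low: "a i \<in> polys_below (mpoly_degree (P i))" if "i \<in> ?I" for i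
  proof -
    \<comment> \<open>Here \<open>deg P i \<ge> 2\<close> enters: subtracting \<open>a i\<close>
      leaves the leading form of \<open>P i\<close> untouched.\<close>
    have "a i \<in> polys_below 2"
      unfolding a_def
      by (intro subspace_add subspace_sum subspace_polys_below)
        (simp_all add: polys_below_def keys_within_def)
    then show ?thesis using polys_below_mono assms(6)[OF that] by blast
  qed
  have P_eval: "mpoly_eval (P i) y = \<phi> i (A y)" if "i \<in> ?I" "y \<in> S0" for i y
  proof -
    have "A y = (\<Sum>j\<in>?I. mpoly_eval (P j) y *\<^sub>R u j)"
      using that(2) assms(2,10) by simp
    then have "\<phi> i (A y) = (\<Sum>j\<in>?I. mpoly_eval (P j) y * \<phi> i (u j))"
      by (simp only: linear_sum[OF \<phi>(1)] linear_scale[OF \<phi>(1)] real_scaleR_def)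
    also have "\<dots> = (\<Sum>j\<in>?I. if j = i then mpoly_eval (P i) y else 0)"
    proof (rule sum.cong)
      fix j assume "j \<in> ?I"
      \<comment> \<open>Injectivity of \<open>u\<close> turns \<open>u j = u i\<close> into
        \<open>j = i\<close>.\<close>
      then show "mpoly_eval (P j) y * \<phi> i (u j) = (if j = i then mpoly_eval (P i) y else 0)"
        using \<phi>(2)[of "u j" i] inj_onD[OF assms(3) _ _ that(1), of j] by auto
    qed simp
    finally show ?thesis using that(1) by simp
  qed
  \<comment> \<open>A uniform bound on all finite subsets yields finiteness of \<open>S0\<close>
    together with the bound itself.\<close>
  have "card F \<le> (\<Prod>i=1..CARD('n). mpoly_degree (P i))" if "finite F" "F \<subseteq> S0" for F
  \<comment> \<open>On \<open>S0\<close> the values of \<open>P i\<close> and \<open>a i\<close>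
    agree, so the leading form takes the values of \<open>a i\<close> minus the lower-order terms of
    \<open>P i\<close>.\<close>
  proof (rule card_common_zeros_le[where p = "\<lambda>i. top_hom (P i)" and r = "\<lambda>i. a i - (P i - top_hom (P i))"])
    \<comment> \<open>This is completeness at infinity in contrapositive form.\<close>
    show "q \<in> ideal_gen ((\<lambda>i. top_hom (P i)) ` {1..<i})"
      if "i \<in> ?I" "q * top_hom (P i) \<in> ideal_gen ((\<lambda>i. top_hom (P i)) ` {1..<i})" for i q
      using assms(7) that unfolding complete_at_infinity_def by blast
    show "a i - (P i - top_hom (P i)) \<in> polys_below (mpoly_degree (P i))" if "i \<in> ?I" for i
      by (rule subspace_diff[OF subspace_polys_below a_low[OF that] diff_top_hom_below])
    show "mpoly_eval (top_hom (P i)) y = mpoly_eval (a i - (P i - top_hom (P i))) y"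
      if "i \<in> ?I" "y \<in> F" for i y
      using P_eval[OF that(1), of y] that(2) \<open>F \<subseteq> S0\<close> by (auto simp: a_eval)
  qed (use that top_hom_homogeneous in auto)
  then show ?thesis
    by (intro finite_if_finite_subsets_card_bdd)
qed

end
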